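(* Let $\mathtt{K}$ be a category and $\varGamma$, $\varPhi$ classes of morphisms in $\mathtt{K}$ such that: RR.1: $\mathtt{K}$ is injectively complete; RR.2: $\varGamma$ is epimorphically complementable in $\mathtt{K}$; RR.3: $\mathtt{K}$ is well-powered in the class $\varGamma$; RR.4: every object of $\mathtt{K}$ is the range of some $\varphi\in\varPhi$, and $\varPhi$ is a left ideal: $\alpha\circ\varphi\in\varPhi$ for every $\varphi\in\varPhi$ and every morphism $\alpha$ of $\mathtt{K}$ composable with it. Then: (a) there is a net of monomorphisms $\mathcal{N}$ in $\mathtt{K}$ such that for each object $X$ of $\mathtt{K}$, in the factorization $\varinjlim\mathcal{N}_X=\mu\circ\varepsilon$ with $\mu\in\varGamma$ and $\varepsilon\in\varGamma^{\downarrow}$ of the local limit $\varinjlim\mathcal{N}_X:X_{\mathcal N}\to X$, the morphism $\mu$ is a refinement $\mathrm{ref}_{\varPhi}^{\varGamma}X$ of $X$ in $\varGamma$ by means of $\varPhi$; (b) for each morphism $\alpha:X\to Y$ in $\mathtt{K}$ and any choice of refinements $\mathrm{ref}_{\varPhi}^{\varGamma}X:\mathrm{Ref}_{\varPhi}^{\varGamma}X\to X$ and $\mathrm{ref}_{\varPhi}^{\varGamma}Y:\mathrm{Ref}_{\varPhi}^{\varGamma}Y\to Y$ there is a unique morphism $\mathrm{Ref}_{\varPhi}^{\varGamma}\alpha:\mathrm{Ref}_{\varPhi}^{\varGamma}X\to\mathrm{Ref}_{\varPhi}^{\varGamma}Y$ such that $\alpha\circ\mathrm{ref}_{\varPhi}^{\varGamma}X=\mathrm{ref}_{\varPhi}^{\varGamma}Y\circ\mathrm{Ref}_{\varPhi}^{\varGamma}\alpha$;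 (c) the refinement $\mathrm{Ref}_{\varPhi}^{\varGamma}$ can be defined as a functor.
   Context: Set-theoretic foundation: Morse–Kelley class theory. $\mathrm{Dom}$ and $\mathrm{Ran}$ denote domain and range. Injectively complete: every functor from a small category has an injective limit (colimit). Enrichments and refinements. A morphism $\sigma:X'\to X$ is an enrichment of $X$ in $\varGamma$ by means of $\varPhi$ if $\sigma\in\varGamma$ and for every morphism $\varphi:B\to X$ in $\varPhi$ there is a unique morphism $\varphi':B\to X'$ with $\varphi=\sigma\circ\varphi'$. An enrichment $\rho:E\to X$ is a refinement of $X$ in $\varGamma$ by means of $\varPhi$ if for every enrichment $\sigma:X'\to X$ (in $\varGamma$ by means of $\varPhi$) there is a unique morphism $\upsilon:E\to X'$ with $\rho=\sigma\circ\upsilon$; one writes $\rho=\mathrm{ref}_\varPhi^\varGamma X$, $E=\mathrm{Ref}_\varPhi^\varGamma X$. Complementability. For morphisms $\mu,\varepsilon$ write $\mu\downarrow\varepsilon$ if for all $\alpha:\mathrm{Dom}\,\varepsilon\to\mathrm{Dom}\,\mu$, $\beta:\mathrm{Ran}\,\varepsilon\to\mathrm{Ran}\,\mu$ with $\mu\circ\alpha=\beta\circ\varepsilon$ there is $\delta:\mathrm{Ran}\,\varepsilon\to\mathrm{Dom}\,\mu$ with $\delta\circ\varepsilon=\alpha$, $\mu\circ\delta=\beta$. For a class $\varLambda$ of morphisms, ${}^{\downarrow}\varLambda$ is the class of monomorphisms $\mu$ with $\mu\downarrow\lambda$ for all $\lambda\in\varLambda$, and $\varLambda^{\downarrow}$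 is the class of epimorphisms $\varepsilon$ with $\lambda\downarrow\varepsilon$ for all $\lambda\in\varLambda$. $\varGamma$ is epimorphically complementable if $\varGamma={}^{\downarrow}(\varGamma^{\downarrow})$ and every morphism of $\mathtt{K}$ is of the form $\mu\circ\varepsilon$ with $\mu\in\varGamma$, $\varepsilon\in\varGamma^{\downarrow}$ (then $\varGamma$ consists of monomorphisms and such a factorization is unique up to isomorphism). $\mathtt{K}$ is well-powered in $\varGamma$ if for every object $X$ the category of morphisms in $\varGamma$ with range $X$ (morphisms from $\rho:A\to X$ to $\sigma:B\to X$ being $\varkappa:A\to B$ with $\sigma\circ\varkappa=\rho$) has a skeleton which is a set. Nets. For monomorphisms $\rho,\sigma$ with common range $X$, $\rho\to\sigma$ means that $\rho=\sigma\circ\varkappa$ for some (necessarily unique) morphism $\varkappa=\varkappa_\rho^\sigma$. A net of monomorphisms is a family $\mathcal N=\{\mathcal N_X\}_{X\in\mathrm{Ob}(\mathtt K)}$, where each $\mathcal{N}_X$ is a set of monomorphisms with range $X$, such that (1) $\mathcal N_X$ is non-empty and for all $\rho,\rho'\in\mathcal N_X$ there is $\sigma\in\mathcal N_X$ with $\rho\to\sigma$, $\rho'\to\sigma$; (2) the system of morphisms $\{\varkappa_\rho^\sigma:\rho,\sigma\in\mathcal N_X,\rho\to\sigma\}$ has an injective limit $X_{\mathcal N}$ in $\mathtt{K}$; (3) for every morphism $\alpha:X\to Y$ and every $\sigma\in\mathcal N_X$ there are $\tau\in\mathcal N_Y$ and $\alpha_\sigma^\tau:\mathrm{Dom}\,\sigma\to\mathrm{Dom}\,\tau$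 with $\tau\circ\alpha_\sigma^\tau=\alpha\circ\sigma$. The local limit $\varinjlim\mathcal N_X:X_{\mathcal N}\to X$ is the morphism from the injective limit induced by the cone $\mathcal N_X$. "$\mathrm{Ref}_\varPhi^\varGamma$ can be defined as a functor" means: there are a map assigning to each object $X$ a refinement $i_X:I(X)\to X$ of $X$ in $\varGamma$ by means of $\varPhi$, and a map assigning to each morphism $\alpha:Y\to X$ a morphism $I(\alpha):I(Y)\to I(X)$ with $i_X\circ I(\alpha)=\alpha\circ i_Y$, such that $I(1_X)=1_{I(X)}$ and $I(\beta\circ\alpha)=I(\beta)\circ I(\alpha)$. *)

theory Defs
  imports Main
begin

text \<open>
  A type \<^typ>\<open>'v\<close> with an extension map \<open>elts\<close> is the universe of sets. Classes are the terms
  of type \<^typ>\<open>'v set\<close>, so class comprehension and (global) choice come from HOL; the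
  remaining axioms of Kelley's formulation of Morse--Kelley are listed below. The axiom of infinity
  is left out: universes with an infinite set are covered as instances, and the
  hereditarily finite sets (Ackermann's membership on the naturals) are one as well.
\<close>

locale mk_universe =
  fixes elts :: "'v \<Rightarrow> 'v set"
  assumes extensionality: "inj elts"
    and subsets: "\<exists>y. \<forall>B. B \<subseteq> elts x \<longrightarrow> (\<exists>z \<in> elts y. elts z = B)"
    and union: "\<exists>z. elts z = elts x \<union> elts y"
    and substitution: "\<exists>y. elts y = f ` elts x"
    and amalgamation: "\<exists>y. elts y = \<Union> (elts ` elts x)"
    and regularity: "A \<noteq> {} \<Longrightarrow> \<exists>x \<in> A. elts x \<inter> A = {}"

text \<open>
  ``\<open>A\<close> is a set.'' For \<open>A\<close> of type \<^typ>\<open>'v set\<close> this says \<open>A = elts y\<close> for some \<open>y\<close>, by substitution;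
  the polymorphic form also applies to classes of tuples of elements of the universe.
\<close>

definition small :: "('v \<Rightarrow> 'v set) \<Rightarrow> 'a set \<Rightarrow> bool" where
  "small elts A \<longleftrightarrow> (\<exists>x f. A = f ` elts x)"


record ('o, 'm) cat =
  Obj :: "'o set"
  Arr :: "'m set"
  Dom :: "'m \<Rightarrow> 'o"
  Ran :: "'m \<Rightarrow> 'o"
  Id :: "'o \<Rightarrow> 'm"
  Comp :: "'m \<Rightarrow> 'm \<Rightarrow> 'm"  (infixr \<open>\<odot>\<index>\<close> 70)

definition hom :: "('o, 'm) cat \<Rightarrow> 'o \<Rightarrow> 'o \<Rightarrow> 'm set" where
  "hom K X Y = {f \<in> Arr K. Dom K f = X \<and> Ran K f = Y}"

text \<open>The operations are total functions in HOL; \<open>g \<odot> f\<close> is meaningful only if \<open>Dom g = Ran f\<close>.\<close>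

definition category :: "('o, 'm) cat \<Rightarrow> bool" where
  "category K \<longleftrightarrow>
    (\<forall>f \<in> Arr K. Dom K f \<in> Obj K \<and> Ran K f \<in> Obj K) \<and>
    (\<forall>X \<in> Obj K. Id K X \<in> hom K X X) \<and>
    (\<forall>f \<in> Arr K. \<forall>g \<in> Arr K. Dom K g = Ran K f \<longrightarrow> g \<odot>\<^bsub>K\<^esub> f \<in> hom K (Dom K f) (Ran K g)) \<and>
    (\<forall>f \<in> Arr K. f \<odot>\<^bsub>K\<^esub> Id K (Dom K f) = f \<and> Id K (Ran K f) \<odot>\<^bsub>K\<^esub> f = f) \<and>
    (\<forall>f \<in> Arr K. \<forall>g \<in> Arr K. \<forall>h \<in> Arr K. Dom K g = Ran K f \<longrightarrow> Dom K h = Ran K g \<longrightarrow>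
      (h \<odot>\<^bsub>K\<^esub> g) \<odot>\<^bsub>K\<^esub> f = h \<odot>\<^bsub>K\<^esub> (g \<odot>\<^bsub>K\<^esub> f))"

definition small_cat :: "('v \<Rightarrow> 'v set) \<Rightarrow> ('o, 'm) cat \<Rightarrow> bool" where
  "small_cat elts K \<longleftrightarrow> small elts (Obj K) \<and> small elts (Arr K)"

definition is_mono :: "('o, 'm) cat \<Rightarrow> 'm \<Rightarrow> bool" where
  "is_mono K m \<longleftrightarrow> m \<in> Arr K \<and>
    (\<forall>f \<in> Arr K. \<forall>g \<in> Arr K. Dom K f = Dom K g \<longrightarrow> Ran K f = Dom K m \<longrightarrow> Ran K g = Dom K m \<longrightarrow>
      m \<odot>\<^bsub>K\<^esub> f = m \<odot>\<^bsub>K\<^esub> g \<longrightarrow> f = g)"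

definition is_epi :: "('o, 'm) cat \<Rightarrow> 'm \<Rightarrow> bool" where
  "is_epi K e \<longleftrightarrow> e \<in> Arr K \<and>
    (\<forall>f \<in> Arr K. \<forall>g \<in> Arr K. Ran K f = Ran K g \<longrightarrow> Dom K f = Ran K e \<longrightarrow> Dom K g = Ran K e \<longrightarrow>
      f \<odot>\<^bsub>K\<^esub> e = g \<odot>\<^bsub>K\<^esub> e \<longrightarrow> f = g)"

definition isomorphic :: "('o, 'm) cat \<Rightarrow> 'o \<Rightarrow> 'o \<Rightarrow> bool" where
  "isomorphic K X Y \<longleftrightarrow> (\<exists>f \<in> hom K X Y. \<exists>g \<in> hom K Y X.
    g \<odot>\<^bsub>K\<^esub> f = Id K X \<and> f \<odot>\<^bsub>K\<^esub> g = Id K Y)"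


definition is_functor ::
    "('i, 'j) cat \<Rightarrow> ('o, 'm) cat \<Rightarrow> ('i \<Rightarrow> 'o) \<Rightarrow> ('j \<Rightarrow> 'm) \<Rightarrow> bool" where
  "is_functor J K Fo Fm \<longleftrightarrow>
    (\<forall>i \<in> Obj J. Fo i \<in> Obj K) \<and>
    (\<forall>f \<in> Arr J. Fm f \<in> hom K (Fo (Dom J f)) (Fo (Ran J f))) \<and>
    (\<forall>i \<in> Obj J. Fm (Id J i) = Id K (Fo i)) \<and>
    (\<forall>f \<in> Arr J. \<forall>g \<in> Arr J. Dom J g = Ran J f \<longrightarrow> Fm (g \<odot>\<^bsub>J\<^esub> f) = Fm g \<odot>\<^bsub>K\<^esub> Fm f)"

definition is_cocone ::
    "('i, 'j) cat \<Rightarrow> ('o, 'm) cat \<Rightarrow> ('i \<Rightarrow> 'o) \<Rightarrow> ('j \<Rightarrow> 'm) \<Rightarrow> 'o \<Rightarrow> ('i \<Rightarrow> 'm) \<Rightarrow> bool" where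
  "is_cocone J K Fo Fm L c \<longleftrightarrow> L \<in> Obj K \<and>
    (\<forall>i \<in> Obj J. c i \<in> hom K (Fo i) L) \<and>
    (\<forall>f \<in> Arr J. c (Ran J f) \<odot>\<^bsub>K\<^esub> Fm f = c (Dom J f))"

definition is_injective_limit ::
    "('i, 'j) cat \<Rightarrow> ('o, 'm) cat \<Rightarrow> ('i \<Rightarrow> 'o) \<Rightarrow> ('j \<Rightarrow> 'm) \<Rightarrow> 'o \<Rightarrow> ('i \<Rightarrow> 'm) \<Rightarrow> bool" where
  "is_injective_limit J K Fo Fm L c \<longleftrightarrow> is_cocone J K Fo Fm L c \<and>
    (\<forall>L' c'. is_cocone J K Fo Fm L' c' \<longrightarrow>
      (\<exists>!u. u \<in> hom K L L' \<and> (\<forall>i \<in> Obj J. u \<odot>\<^bsub>K\<^esub> c i = c' i)))"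

definition injectively_complete :: "('v \<Rightarrow> 'v set) \<Rightarrow> ('o, 'm) cat \<Rightarrow> bool" where
  "injectively_complete elts K \<longleftrightarrow>
    (\<forall>(J :: ('v, 'v) cat) Fo Fm. category J \<longrightarrow> small_cat elts J \<longrightarrow> is_functor J K Fo Fm \<longrightarrow>
      (\<exists>L c. is_injective_limit J K Fo Fm L c))"


definition lifts :: "('o, 'm) cat \<Rightarrow> 'm \<Rightarrow> 'm \<Rightarrow> bool" where
  "lifts K \<mu> \<epsilon> \<longleftrightarrow>
    (\<forall>\<alpha> \<in> hom K (Dom K \<epsilon>) (Dom K \<mu>). \<forall>\<beta> \<in> hom K (Ran K \<epsilon>) (Ran K \<mu>).
      \<mu> \<odot>\<^bsub>K\<^esub> \<alpha> = \<beta> \<odot>\<^bsub>K\<^esub> \<epsilon> \<longrightarrow>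
      (\<exists>\<delta> \<in> hom K (Ran K \<epsilon>) (Dom K \<mu>). \<delta> \<odot>\<^bsub>K\<^esub> \<epsilon> = \<alpha> \<and> \<mu> \<odot>\<^bsub>K\<^esub> \<delta> = \<beta>))"

definition mono_complement :: "('o, 'm) cat \<Rightarrow> 'm set \<Rightarrow> 'm set" where
  "mono_complement K \<Lambda> = {\<mu>. is_mono K \<mu> \<and> (\<forall>\<epsilon> \<in> \<Lambda>. lifts K \<mu> \<epsilon>)}"

definition epi_complement :: "('o, 'm) cat \<Rightarrow> 'm set \<Rightarrow> 'm set" where
  "epi_complement K \<Lambda> = {\<epsilon>. is_epi K \<epsilon> \<and> (\<forall>\<mu> \<in> \<Lambda>. lifts K \<mu> \<epsilon>)}"

definition factorization :: "('o, 'm) cat \<Rightarrow> 'm set \<Rightarrow> 'm \<Rightarrow> 'm \<Rightarrow> 'm \<Rightarrow> bool" where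
  "factorization K \<Gamma> f \<mu> \<epsilon> \<longleftrightarrow>
    \<mu> \<in> \<Gamma> \<and> \<epsilon> \<in> epi_complement K \<Gamma> \<and> Dom K \<mu> = Ran K \<epsilon> \<and> f = \<mu> \<odot>\<^bsub>K\<^esub> \<epsilon>"

definition epimorphically_complementable :: "('o, 'm) cat \<Rightarrow> 'm set \<Rightarrow> bool" where
  "epimorphically_complementable K \<Gamma> \<longleftrightarrow>
    \<Gamma> = mono_complement K (epi_complement K \<Gamma>) \<and>
    (\<forall>f \<in> Arr K. \<exists>\<mu> \<epsilon>. factorization K \<Gamma> f \<mu> \<epsilon>)"


text \<open>
  The category of morphisms in \<open>\<Gamma>\<close> with range \<open>X\<close>; a triple \<open>(\<rho>, \<kappa>, \<sigma>)\<close> is the morphism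
  \<open>\<kappa>\<close> viewed as going from \<open>\<rho>\<close> to \<open>\<sigma>\<close>.
\<close>

definition over_cat :: "('o, 'm) cat \<Rightarrow> 'm set \<Rightarrow> 'o \<Rightarrow> ('m, 'm \<times> 'm \<times> 'm) cat" where
  "over_cat K \<Gamma> X =
    \<lparr> Obj = {\<sigma> \<in> \<Gamma>. \<sigma> \<in> Arr K \<and> Ran K \<sigma> = X},
      Arr = {(\<rho>, \<kappa>, \<sigma>). \<rho> \<in> \<Gamma> \<and> \<rho> \<in> Arr K \<and> Ran K \<rho> = X \<and> \<sigma> \<in> \<Gamma> \<and> \<sigma> \<in> Arr K \<and> Ran K \<sigma> = X \<and>
              \<kappa> \<in> hom K (Dom K \<rho>) (Dom K \<sigma>) \<and> \<sigma> \<odot>\<^bsub>K\<^esub> \<kappa> = \<rho>},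
      Dom = (\<lambda>(\<rho>, \<kappa>, \<sigma>). \<rho>),
      Ran = (\<lambda>(\<rho>, \<kappa>, \<sigma>). \<sigma>),
      Id = (\<lambda>\<sigma>. (\<sigma>, Id K (Dom K \<sigma>), \<sigma>)),
      Comp = (\<lambda>(\<sigma>, \<kappa>', \<tau>) (\<rho>, \<kappa>, _). (\<rho>, \<kappa>' \<odot>\<^bsub>K\<^esub> \<kappa>, \<tau>)) \<rparr>"

definition full_subcat :: "('o, 'm) cat \<Rightarrow> 'o set \<Rightarrow> ('o, 'm) cat" where
  "full_subcat K S = K \<lparr> Obj := S, Arr := {f \<in> Arr K. Dom K f \<in> S \<and> Ran K f \<in> S} \<rparr>"

definition is_skeleton :: "('o, 'm) cat \<Rightarrow> ('o, 'm) cat \<Rightarrow> bool" where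
  "is_skeleton K T \<longleftrightarrow> (\<exists>S \<subseteq> Obj K. T = full_subcat K S \<and>
    (\<forall>X \<in> Obj K. \<exists>!Y. Y \<in> S \<and> isomorphic K X Y))"

definition well_powered :: "('v \<Rightarrow> 'v set) \<Rightarrow> ('o, 'm) cat \<Rightarrow> 'm set \<Rightarrow> bool" where
  "well_powered elts K \<Gamma> \<longleftrightarrow>
    (\<forall>X \<in> Obj K. \<exists>T. is_skeleton (over_cat K \<Gamma> X) T \<and> small_cat elts T)"


definition is_enrichment ::
    "('o, 'm) cat \<Rightarrow> 'm set \<Rightarrow> 'm set \<Rightarrow> 'o \<Rightarrow> 'm \<Rightarrow> bool" where
  "is_enrichment K \<Gamma> \<Phi> X \<sigma> \<longleftrightarrow> \<sigma> \<in> Arr K \<and> Ran K \<sigma> = X \<and> \<sigma> \<in> \<Gamma> \<and>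
    (\<forall>\<phi> \<in> \<Phi>. Ran K \<phi> = X \<longrightarrow>
      (\<exists>!\<phi>'. \<phi>' \<in> hom K (Dom K \<phi>) (Dom K \<sigma>) \<and> \<phi> = \<sigma> \<odot>\<^bsub>K\<^esub> \<phi>'))"

definition is_refinement ::
    "('o, 'm) cat \<Rightarrow> 'm set \<Rightarrow> 'm set \<Rightarrow> 'o \<Rightarrow> 'm \<Rightarrow> bool" where
  "is_refinement K \<Gamma> \<Phi> X \<rho> \<longleftrightarrow> is_enrichment K \<Gamma> \<Phi> X \<rho> \<and>
    (\<forall>\<sigma>. is_enrichment K \<Gamma> \<Phi> X \<sigma> \<longrightarrow>
      (\<exists>!\<upsilon>. \<upsilon> \<in> hom K (Dom K \<rho>) (Dom K \<sigma>) \<and> \<rho> = \<sigma> \<odot>\<^bsub>K\<^esub> \<upsilon>))"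


definition factors_through :: "('o, 'm) cat \<Rightarrow> 'm \<Rightarrow> 'm \<Rightarrow> bool" where
  "factors_through K \<rho> \<sigma> \<longleftrightarrow> (\<exists>\<kappa> \<in> hom K (Dom K \<rho>) (Dom K \<sigma>). \<rho> = \<sigma> \<odot>\<^bsub>K\<^esub> \<kappa>)"

definition transit :: "('o, 'm) cat \<Rightarrow> 'm \<Rightarrow> 'm \<Rightarrow> 'm" where
  "transit K \<rho> \<sigma> = (THE \<kappa>. \<kappa> \<in> hom K (Dom K \<rho>) (Dom K \<sigma>) \<and> \<rho> = \<sigma> \<odot>\<^bsub>K\<^esub> \<kappa>)"

text \<open>
  The system of morphisms \<open>transit K \<rho> \<sigma>\<close> with \<open>\<rho>, \<sigma> \<in> N\<close> is a diagram indexed by the preorder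
  \<open>factors_through K\<close> on \<open>N\<close>, regarded as a category with pairs \<open>(\<rho>, \<sigma>)\<close> as arrows.
\<close>

definition net_index :: "('o, 'm) cat \<Rightarrow> 'm set \<Rightarrow> ('m, 'm \<times> 'm) cat" where
  "net_index K N =
    \<lparr> Obj = N,
      Arr = {(\<rho>, \<sigma>). \<rho> \<in> N \<and> \<sigma> \<in> N \<and> factors_through K \<rho> \<sigma>},
      Dom = fst,
      Ran = snd,
      Id = (\<lambda>\<rho>. (\<rho>, \<rho>)),
      Comp = (\<lambda>g f. (fst f, snd g)) \<rparr>"

definition net_limit :: "('o, 'm) cat \<Rightarrow> 'm set \<Rightarrow> 'o \<Rightarrow> ('m \<Rightarrow> 'm) \<Rightarrow> bool" where
  "net_limit K N L c \<longleftrightarrow>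
    is_injective_limit (net_index K N) K (Dom K) (\<lambda>(\<rho>, \<sigma>). transit K \<rho> \<sigma>) L c"

definition net_of_monos ::
    "('v \<Rightarrow> 'v set) \<Rightarrow> ('o, 'm) cat \<Rightarrow> ('o \<Rightarrow> 'm set) \<Rightarrow> bool" where
  "net_of_monos elts K N \<longleftrightarrow>
    (\<forall>X \<in> Obj K. small elts (N X) \<and> (\<forall>\<rho> \<in> N X. is_mono K \<rho> \<and> Ran K \<rho> = X)) \<and>
    (\<forall>X \<in> Obj K. N X \<noteq> {} \<and>
      (\<forall>\<rho> \<in> N X. \<forall>\<rho>' \<in> N X. \<exists>\<sigma> \<in> N X. factors_through K \<rho> \<sigma> \<and> factors_through K \<rho>' \<sigma>)) \<and>
    (\<forall>X \<in> Obj K. \<exists>L c. net_limit K (N X) L c) \<and>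
    (\<forall>X \<in> Obj K. \<forall>Y \<in> Obj K. \<forall>\<alpha> \<in> hom K X Y. \<forall>\<sigma> \<in> N X. \<exists>\<tau> \<in> N Y.
      \<exists>\<alpha>' \<in> hom K (Dom K \<sigma>) (Dom K \<tau>). \<tau> \<odot>\<^bsub>K\<^esub> \<alpha>' = \<alpha> \<odot>\<^bsub>K\<^esub> \<sigma>)"

text \<open>
  The injective limit is determined only up to isomorphism, hence so is the local limit:
  \<open>l\<close> is the local limit for some choice of the injective limit.
\<close>

definition is_local_limit ::
    "('o, 'm) cat \<Rightarrow> ('o \<Rightarrow> 'm set) \<Rightarrow> 'o \<Rightarrow> 'm \<Rightarrow> bool" where
  "is_local_limit K N X l \<longleftrightarrow>
    (\<exists>L c. net_limit K (N X) L c \<and> l \<in> hom K L X \<and> (\<forall>\<rho> \<in> N X. l \<odot>\<^bsub>K\<^esub> c \<rho> = \<rho>))"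


definition refinement_functorial :: "('o, 'm) cat \<Rightarrow> 'm set \<Rightarrow> 'm set \<Rightarrow> bool" where
  "refinement_functorial K \<Gamma> \<Phi> \<longleftrightarrow>
    (\<exists>I i Im.
      (\<forall>X \<in> Obj K. is_refinement K \<Gamma> \<Phi> X (i X) \<and> i X \<in> hom K (I X) X) \<and>
      (\<forall>Y \<in> Obj K. \<forall>X \<in> Obj K. \<forall>\<alpha> \<in> hom K Y X.
        Im \<alpha> \<in> hom K (I Y) (I X) \<and> i X \<odot>\<^bsub>K\<^esub> Im \<alpha> = \<alpha> \<odot>\<^bsub>K\<^esub> i Y) \<and>
      is_functor K K I Im)"

end

theory Submission
  imports Defs
begin

text \<open>
  A morphism in \<open>\<Gamma>\<close> with range \<open>X\<close> is an enrichment of \<open>X\<close> iff every \<open>\<phi> \<in> \<Phi>\<close> with range \<open>X\<close> factors through it. The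
  union in \<open>\<Gamma>\<close> of the images of these \<open>\<phi>\<close> (the image of a coproduct, which is small since \<open>K\<close> is
  well-powered in \<open>\<Gamma>\<close>) is therefore the least enrichment, that is, the refinement. The lifting
  property shows more: if \<open>\<alpha> \<circ> \<phi>\<close> factors through \<open>s \<in> \<Gamma>\<close> for each \<open>\<phi>\<close>, then so does \<open>\<alpha>\<close> composed
  with the refinement. As \<open>\<Phi>\<close> is a left ideal, this makes refinements functorial, so that choosing
  one refinement for each object gives a net of singletons, whose local limits are the refinements.
\<close>

section \<open>Small classes\<close>

lemma (in mk_universe) small_subset:
  assumes "small elts A" and "B \<subseteq> A"
  shows "small elts B"
proof -
  obtain x f where A: "A = f ` elts x"
    using assms(1) unfolding small_def by blast
  \<comment> \<open>The subclass is cut out on the index side, because \<open>small\<close> presents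
    \<open>A\<close> only as an image of a set and \<open>subsets\<close> speaks of elements of the
    universe.\<close>
  obtain z where "elts z = {i \<in> elts x. f i \<in> B}"
    using subsets[of x] by (metis (no_types, lifting) mem_Collect_eq subsetI)
  then have "B = f ` elts z"
    using A assms(2) by auto
  then show ?thesis
    unfolding small_def by blast
qed

lemma (in mk_universe) small_singleton: "small elts {a}"
proof -
  \<comment> \<open>Applied to the empty class, \<open>subsets\<close> yields a nonempty set; a
    constant map on it has image \<open>{a}\<close>, for \<open>a\<close> of any type.\<close>
  obtain y z where "z \<in> elts y"
    using subsets by blast
  then have "{a} = (\<lambda>_. a) ` elts y"
    by auto
  then show ?thesis
    unfolding small_def by blast
qed

section \<open>Composition and factoring in a category\<close>

lemma homI: "f \<in> Arr K \<Longrightarrow> Dom K f = X \<Longrightarrow> Ran K f = Y \<Longrightarrow> f \<in> hom K X Y"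
  by (simp add: hom_def)

lemma homD:
  assumes "f \<in> hom K X Y"
  shows "f \<in> Arr K" "Dom K f = X" "Ran K f = Y"
  using assms by (auto simp: hom_def)

lemma factors_throughI:
  "\<kappa> \<in> hom K (Dom K f) (Dom K \<sigma>) \<Longrightarrow> f = \<sigma> \<odot>\<^bsub>K\<^esub> \<kappa> \<Longrightarrow> factors_through K f \<sigma>"
  unfolding factors_through_def by blast

locale cat_axioms =
  fixes K :: "('o, 'm) cat" (structure)
  assumes K: "category K"
begin

lemma
  assumes "f \<in> Arr K"
  shows Dom_Obj [simp]: "Dom K f \<in> Obj K"
    and Ran_Obj [simp]: "Ran K f \<in> Obj K"
    and comp_Id [simp]: "f \<odot> Id K (Dom K f) = f"
    and Id_comp [simp]: "Id K (Ran K f) \<odot> f = f"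
  using K assms unfolding category_def by blast+

lemma Id_hom: "X \<in> Obj K \<Longrightarrow> Id K X \<in> hom K X X"
  using K unfolding category_def by blast

lemma
  assumes "X \<in> Obj K"
  shows Id_Arr [simp]: "Id K X \<in> Arr K"
    and Dom_Id [simp]: "Dom K (Id K X) = X"
    and Ran_Id [simp]: "Ran K (Id K X) = X"
  using homD[OF Id_hom[OF assms]] by auto

lemma
  assumes "f \<in> Arr K" "g \<in> Arr K" "Dom K g = Ran K f"
  shows comp_Arr [simp]: "g \<odot> f \<in> Arr K"
    and Dom_comp [simp]: "Dom K (g \<odot> f) = Dom K f"
    and Ran_comp [simp]: "Ran K (g \<odot> f) = Ran K g"
proof -
  have "g \<odot> f \<in> hom K (Dom K f) (Ran K g)"
    using K assms unfolding category_def by blast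
  then show "g \<odot> f \<in> Arr K" "Dom K (g \<odot> f) = Dom K f" "Ran K (g \<odot> f) = Ran K g"
    by (auto dest: homD)
qed

lemma hom_Obj: "f \<in> hom K X Y \<Longrightarrow> Y \<in> Obj K"
  by (auto simp: hom_def)

lemma hom_comp_Id: "f \<in> hom K X Y \<Longrightarrow> f \<odot> Id K X = f"
  by (auto simp: hom_def)

lemma assoc:
  assumes "f \<in> Arr K" "g \<in> Arr K" "h \<in> Arr K" "Dom K g = Ran K f" "Dom K h = Ran K g"
  shows "(h \<odot> g) \<odot> f = h \<odot> (g \<odot> f)"
  using K assms unfolding category_def by blast

lemma factors_through_trans:
  assumes "factors_through K f g" "factors_through K g h" "h \<in> Arr K"
  shows "factors_through K f h"
proof -
  obtain \<kappa> where \<kappa>: "\<kappa> \<in> hom K (Dom K f) (Dom K g)" "f = g \<odot> \<kappa>"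
    using assms(1) unfolding factors_through_def by blast
  obtain \<eta> where \<eta>: "\<eta> \<in> hom K (Dom K g) (Dom K h)" "g = h \<odot> \<eta>"
    using assms(2) unfolding factors_through_def by blast
  note h = homD[OF \<kappa>(1)] homD[OF \<eta>(1)]
  show ?thesis
  proof (rule factors_throughI)
    show "\<eta> \<odot> \<kappa> \<in> hom K (Dom K f) (Dom K h)"
      by (rule homI) (use h in auto)
    have "f = (h \<odot> \<eta>) \<odot> \<kappa>"
      using \<kappa>(2) \<eta>(2) by simp
    also have "\<dots> = h \<odot> (\<eta> \<odot> \<kappa>)"
      by (rule assoc) (use h assms(3) in auto)
    finally show "f = h \<odot> (\<eta> \<odot> \<kappa>)" .
  qed
qed

lemma factors_through_comp_left:
  assumes "factors_through K f g" "g \<in> Arr K" "\<alpha> \<in> Arr K" "Dom K \<alpha> = Ran K g"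
  shows "factors_through K (\<alpha> \<odot> f) (\<alpha> \<odot> g)"
proof -
  obtain \<kappa> where \<kappa>: "\<kappa> \<in> hom K (Dom K f) (Dom K g)" "f = g \<odot> \<kappa>"
    using assms(1) unfolding factors_through_def by blast
  note h = homD[OF \<kappa>(1)]
  show ?thesis
    by (rule factors_throughI[of \<kappa>])
      (use h \<kappa>(2) assms(2-) in \<open>auto simp: assoc intro!: homI\<close>)
qed

lemma mono_cancel:
  assumes "is_mono K m" "f \<in> hom K A (Dom K m)" "g \<in> hom K A (Dom K m)" "m \<odot> f = m \<odot> g"
  shows "f = g"
  using assms unfolding is_mono_def hom_def by auto

text \<open>Reduces the unique existence in the definitions of enrichment and refinement to
  \<open>factors_through\<close>.\<close>

lemma ex1_factor_iff:
  assumes "is_mono K m"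
  shows "(\<exists>!u. u \<in> hom K A (Dom K m) \<and> f = m \<odot> u) \<longleftrightarrow> (\<exists>u \<in> hom K A (Dom K m). f = m \<odot> u)"
  using mono_cancel[OF assms] by metis

section \<open>Coproducts, representatives of subobjects, and diagonals\<close>

lemma coproduct_exists:
  assumes "injectively_complete elts K" and F: "\<And>i. i \<in> elts x \<Longrightarrow> F i \<in> Obj K"
  shows "\<exists>L c. L \<in> Obj K \<and> (\<forall>i \<in> elts x. c i \<in> hom K (F i) L) \<and>
    (\<forall>L' c'. L' \<in> Obj K \<longrightarrow> (\<forall>i \<in> elts x. c' i \<in> hom K (F i) L') \<longrightarrow>
      (\<exists>!u. u \<in> hom K L L' \<and> (\<forall>i \<in> elts x. u \<odot> c i = c' i)))"
proof -
  \<comment> \<open>The discrete category on the index set: each element is its own identity, and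
    composable arrows coincide, so either argument may serve as their composite.\<close>
  define J :: "('a, 'a) cat" where
    "J = \<lparr> Obj = elts x, Arr = elts x, Dom = id, Ran = id, Id = id, Comp = (\<lambda>g f. f) \<rparr>"
  have "category J"
    by (auto simp: category_def J_def hom_def)
  moreover have "small_cat elts J"
    unfolding small_cat_def small_def J_def by (simp, metis image_ident)
  moreover have "is_functor J K F (\<lambda>i. Id K (F i))"
    using F by (simp add: is_functor_def J_def Id_hom hom_comp_Id[OF Id_hom])
  ultimately obtain L c where Lc: "is_injective_limit J K F (\<lambda>i. Id K (F i)) L c"
    using assms(1) unfolding injectively_complete_def by blast
  \<comment> \<open>All arrows of \<open>J\<close> go to identities, so compatibility is automatic
    and a cocone is just a family of morphisms.\<close>
  have cocone: "is_cocone J K F (\<lambda>i. Id K (F i)) L' c' \<longleftrightarrow>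
      L' \<in> Obj K \<and> (\<forall>i \<in> elts x. c' i \<in> hom K (F i) L')" for L' c'
    by (simp add: is_cocone_def J_def) (blast intro: hom_comp_Id)
  have "Obj J = elts x"
    by (simp add: J_def)
  with Lc show ?thesis
    unfolding is_injective_limit_def cocone by (intro exI[of _ L] exI[of _ c]) simp
qed

lemma isomorphic_over_cat_imp_factors:
  assumes "isomorphic (over_cat K \<Gamma> X) \<rho> \<sigma>"
  shows "factors_through K \<rho> \<sigma>" "factors_through K \<sigma> \<rho>"
proof -
  have "factors_through K \<rho>' \<sigma>'" if f: "f \<in> hom (over_cat K \<Gamma> X) \<rho>' \<sigma>'" for f \<rho>' \<sigma>'
  proof -
    obtain \<kappa> where "\<kappa> \<in> hom K (Dom K \<rho>') (Dom K \<sigma>')" "\<sigma>' \<odot> \<kappa> = \<rho>'"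
      using homD[OF f] by (cases f) (simp add: over_cat_def, blast)
    then show ?thesis
      unfolding factors_through_def by blast
  qed
  then show "factors_through K \<rho> \<sigma>" "factors_through K \<sigma> \<rho>"
    using assms unfolding isomorphic_def by blast+
qed

text \<open>The objects of a small skeleton serve as \<open>S\<close>; isomorphism over
  \<open>X\<close> is retained only as factoring in both directions.\<close>

lemma well_powered_representatives:
  assumes "well_powered elts K \<Gamma>" "X \<in> Obj K"
  shows "\<exists>S \<subseteq> {\<sigma> \<in> \<Gamma>. \<sigma> \<in> Arr K \<and> Ran K \<sigma> = X}. small elts S \<and>
    (\<forall>\<rho> \<in> \<Gamma>. \<rho> \<in> Arr K \<longrightarrow> Ran K \<rho> = X \<longrightarrow>
      (\<exists>\<sigma> \<in> S. factors_through K \<rho> \<sigma> \<and> factors_through K \<sigma> \<rho>))"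
proof -
  obtain T where T: "is_skeleton (over_cat K \<Gamma> X) T" "small_cat elts T"
    using assms unfolding well_powered_def by blast
  obtain S where S: "S \<subseteq> Obj (over_cat K \<Gamma> X)" "T = full_subcat (over_cat K \<Gamma> X) S"
    "\<forall>\<rho> \<in> Obj (over_cat K \<Gamma> X). \<exists>!\<sigma>. \<sigma> \<in> S \<and> isomorphic (over_cat K \<Gamma> X) \<rho> \<sigma>"
    using T(1) unfolding is_skeleton_def by blast
  have Obj: "Obj (over_cat K \<Gamma> X) = {\<sigma> \<in> \<Gamma>. \<sigma> \<in> Arr K \<and> Ran K \<sigma> = X}"
    by (simp add: over_cat_def)
  show ?thesis
  proof (intro exI[of _ S] conjI ballI impI)
    show "small elts S"
      using T(2) S(2) by (simp add: small_cat_def full_subcat_def)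
    show "S \<subseteq> {\<sigma> \<in> \<Gamma>. \<sigma> \<in> Arr K \<and> Ran K \<sigma> = X}"
      using S(1) Obj by simp
    fix \<rho>
    assume "\<rho> \<in> \<Gamma>" "\<rho> \<in> Arr K" "Ran K \<rho> = X"
    then show "\<exists>\<sigma> \<in> S. factors_through K \<rho> \<sigma> \<and> factors_through K \<sigma> \<rho>"
      using S(3) Obj isomorphic_over_cat_imp_factors by blast
  qed
qed

text \<open>The form in which the lifting property is applied: a factorization of
  \<open>f \<odot> \<epsilon>\<close> through \<open>s\<close> is a commutative square, and its
  diagonal factors \<open>f\<close> through \<open>s\<close>.\<close>

lemma factors_through_cancel_epi_complement:
  assumes "s \<in> \<Gamma>" "s \<in> Arr K" "\<epsilon> \<in> epi_complement K \<Gamma>" "f \<in> Arr K" "Dom K f = Ran K \<epsilon>"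
    and "Ran K s = Ran K f" and "factors_through K (f \<odot> \<epsilon>) s"
  shows "factors_through K f s"
proof -
  have \<epsilon>: "\<epsilon> \<in> Arr K" "lifts K s \<epsilon>"
    using assms(1,3) unfolding epi_complement_def is_epi_def by auto
  obtain \<kappa> where "\<kappa> \<in> hom K (Dom K \<epsilon>) (Dom K s)" "f \<odot> \<epsilon> = s \<odot> \<kappa>"
    using assms(7) Dom_comp[OF \<epsilon>(1) assms(4,5)] unfolding factors_through_def by metis
  moreover have "f \<in> hom K (Ran K \<epsilon>) (Ran K s)"
    by (rule homI) (use assms in auto)
  ultimately obtain \<delta> where "\<delta> \<in> hom K (Ran K \<epsilon>) (Dom K s)" "s \<odot> \<delta> = f"
    using \<epsilon>(2) unfolding lifts_def by metis
  then show ?thesis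
    using assms(5) by (intro factors_throughI[of \<delta>]) auto
qed

end

text \<open>The test morphism \<alpha> is arbitrary so that one notion serves two ends: \<alpha> =
  \<open>Id K X\<close> puts \<rho> below every enrichment, and general \<alpha> provides the maps
  between refinements. The condition holds for the image of each \<phi> and survives unions, which
  makes it provable for the refinement.\<close>

definition dominated_by :: "('o, 'm) cat \<Rightarrow> 'm set \<Rightarrow> 'm set \<Rightarrow> 'o \<Rightarrow> 'm \<Rightarrow> bool" where
  "dominated_by K \<Gamma> \<Phi> X \<rho> \<longleftrightarrow>
    (\<forall>\<alpha> \<in> Arr K. \<forall>s \<in> \<Gamma>. Dom K \<alpha> = X \<longrightarrow> Ran K s = Ran K \<alpha> \<longrightarrow>
      (\<forall>\<phi> \<in> \<Phi>. Ran K \<phi> = X \<longrightarrow> factors_through K (\<alpha> \<odot>\<^bsub>K\<^esub> \<phi>) s) \<longrightarrow>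
      factors_through K (\<alpha> \<odot>\<^bsub>K\<^esub> \<rho>) s)"

section \<open>Enrichments, refinements and domination\<close>

locale complementable_cat = cat_axioms K for K :: "('o, 'm) cat" (structure) +
  fixes \<Gamma> \<Phi> :: "'m set"
  assumes \<Phi>: "\<Phi> \<subseteq> Arr K"
    and complementable: "epimorphically_complementable K \<Gamma>"
begin

lemma \<Gamma>_mono: "\<mu> \<in> \<Gamma> \<Longrightarrow> is_mono K \<mu>"
  using complementable unfolding epimorphically_complementable_def mono_complement_def by blast

lemma \<Gamma>_Arr: "\<mu> \<in> \<Gamma> \<Longrightarrow> \<mu> \<in> Arr K"
  using \<Gamma>_mono unfolding is_mono_def by blast

lemma factorizationD:
  assumes "factorization K \<Gamma> f \<mu> \<epsilon>"
  shows "\<mu> \<in> \<Gamma>" "\<mu> \<in> Arr K" "\<epsilon> \<in> epi_complement K \<Gamma>" "\<epsilon> \<in> Arr K" "Dom K \<mu> = Ran K \<epsilon>"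
    "f = \<mu> \<odot> \<epsilon>" "Ran K f = Ran K \<mu>" "Dom K f = Dom K \<epsilon>"
proof -
  show *: "\<mu> \<in> \<Gamma>" "\<epsilon> \<in> epi_complement K \<Gamma>" "Dom K \<mu> = Ran K \<epsilon>" "f = \<mu> \<odot> \<epsilon>"
    using assms unfolding factorization_def by auto
  show **: "\<mu> \<in> Arr K" "\<epsilon> \<in> Arr K"
    using * \<Gamma>_Arr unfolding epi_complement_def is_epi_def by auto
  show "Ran K f = Ran K \<mu>" "Dom K f = Dom K \<epsilon>"
    using * ** by auto
qed

lemma factorization_exists:
  assumes "f \<in> Arr K"
  shows "\<exists>\<mu> \<epsilon>. factorization K \<Gamma> f \<mu> \<epsilon>"
  using assms complementable unfolding epimorphically_complementable_def by blast

lemma is_enrichment_iff: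
  "is_enrichment K \<Gamma> \<Phi> X \<sigma> \<longleftrightarrow>
    \<sigma> \<in> \<Gamma> \<and> Ran K \<sigma> = X \<and> (\<forall>\<phi> \<in> \<Phi>. Ran K \<phi> = X \<longrightarrow> factors_through K \<phi> \<sigma>)"
proof (cases "\<sigma> \<in> \<Gamma>")
  case True
  show ?thesis
    unfolding is_enrichment_def factors_through_def ex1_factor_iff[OF \<Gamma>_mono[OF True]]
    using True \<Gamma>_Arr[OF True] by simp
qed (simp add: is_enrichment_def)

lemma is_refinement_iff:
  "is_refinement K \<Gamma> \<Phi> X \<rho> \<longleftrightarrow> is_enrichment K \<Gamma> \<Phi> X \<rho> \<and>
    (\<forall>\<sigma>. is_enrichment K \<Gamma> \<Phi> X \<sigma> \<longrightarrow> factors_through K \<rho> \<sigma>)"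
proof -
  have "(\<exists>!\<upsilon>. \<upsilon> \<in> hom K (Dom K \<rho>) (Dom K \<sigma>) \<and> \<rho> = \<sigma> \<odot> \<upsilon>) \<longleftrightarrow> factors_through K \<rho> \<sigma>"
    if "is_enrichment K \<Gamma> \<Phi> X \<sigma>" for \<sigma>
    using that ex1_factor_iff[OF \<Gamma>_mono] unfolding is_enrichment_iff factors_through_def by blast
  then show ?thesis
    unfolding is_refinement_def by (simp cong: imp_cong)
qed

lemma is_refinementD:
  assumes "is_refinement K \<Gamma> \<Phi> X \<rho>"
  shows "\<rho> \<in> \<Gamma>" "\<rho> \<in> Arr K" "Ran K \<rho> = X" "is_mono K \<rho>" "is_enrichment K \<Gamma> \<Phi> X \<rho>"
  using assms \<Gamma>_Arr \<Gamma>_mono unfolding is_refinement_iff is_enrichment_iff by blast+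

text \<open>Domination passes downwards along \<open>factors_through\<close>. This carries it from
  an image to its representative in the skeleton, and from the constructed refinement to any
  other.\<close>

lemma dominated_by_factor:
  assumes "dominated_by K \<Gamma> \<Phi> X \<sigma>" "factors_through K \<rho> \<sigma>" "\<sigma> \<in> Arr K" "Ran K \<sigma> = X"
  shows "dominated_by K \<Gamma> \<Phi> X \<rho>"
  unfolding dominated_by_def
proof (intro ballI impI)
  fix \<alpha> s
  assume *: "\<alpha> \<in> Arr K" "s \<in> \<Gamma>" "Dom K \<alpha> = X" "Ran K s = Ran K \<alpha>"
    "\<forall>\<phi> \<in> \<Phi>. Ran K \<phi> = X \<longrightarrow> factors_through K (\<alpha> \<odot> \<phi>) s"
  then have "factors_through K (\<alpha> \<odot> \<sigma>) s"
    using assms(1) unfolding dominated_by_def by blast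
  moreover have "factors_through K (\<alpha> \<odot> \<rho>) (\<alpha> \<odot> \<sigma>)"
    using * assms by (intro factors_through_comp_left) auto
  ultimately show "factors_through K (\<alpha> \<odot> \<rho>) s"
    using factors_through_trans \<Gamma>_Arr[OF *(2)] by blast
qed

text \<open>By hypothesis \<open>\<alpha> \<odot> \<phi>\<close>, which equals
  \<open>(\<alpha> \<odot> \<mu>) \<odot> \<epsilon>\<close>, factors through \<open>s\<close>; the
  diagonal cancels \<epsilon>.\<close>

lemma dominated_by_image:
  assumes "\<phi> \<in> \<Phi>" "Ran K \<phi> = X" "factorization K \<Gamma> \<phi> \<mu> \<epsilon>"
  shows "dominated_by K \<Gamma> \<Phi> X \<mu>"
  unfolding dominated_by_def
proof (intro ballI impI)
  note f = factorizationD[OF assms(3)]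
  fix \<alpha> s
  assume *: "\<alpha> \<in> Arr K" "s \<in> \<Gamma>" "Dom K \<alpha> = X" "Ran K s = Ran K \<alpha>"
    "\<forall>\<phi> \<in> \<Phi>. Ran K \<phi> = X \<longrightarrow> factors_through K (\<alpha> \<odot> \<phi>) s"
  have "\<alpha> \<odot> \<phi> = (\<alpha> \<odot> \<mu>) \<odot> \<epsilon>"
    using f * assms(2) by (simp add: assoc)
  then have "factors_through K ((\<alpha> \<odot> \<mu>) \<odot> \<epsilon>) s"
    using *(5) assms(1,2) by metis
  then show "factors_through K (\<alpha> \<odot> \<mu>) s"
    by (rule factors_through_cancel_epi_complement[rotated -1])
      (use f * \<Gamma>_Arr assms(2) in auto)
qed

text \<open>With \<alpha> = \<open>Id K X\<close> and \<open>s\<close> = \<sigma>, the premise of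
  domination is the enrichment property of \<sigma>.\<close>

lemma enrichment_dominated_imp_refinement:
  assumes "is_enrichment K \<Gamma> \<Phi> X \<rho>" "dominated_by K \<Gamma> \<Phi> X \<rho>"
  shows "is_refinement K \<Gamma> \<Phi> X \<rho>"
  unfolding is_refinement_iff
proof (intro conjI allI impI)
  fix \<sigma>
  assume \<sigma>: "is_enrichment K \<Gamma> \<Phi> X \<sigma>"
  have X: "X \<in> Obj K" "\<rho> \<in> Arr K" "Ran K \<rho> = X"
    using assms(1) \<Gamma>_Arr unfolding is_enrichment_iff by auto
  have "factors_through K (Id K X \<odot> \<phi>) \<sigma>" if "\<phi> \<in> \<Phi>" "Ran K \<phi> = X" for \<phi>
    using that \<sigma> \<Phi> unfolding is_enrichment_iff by auto
  then have "factors_through K (Id K X \<odot> \<rho>) \<sigma>"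
    using assms(2) \<sigma> X unfolding dominated_by_def is_enrichment_iff by auto
  then show "factors_through K \<rho> \<sigma>"
    using X by auto
qed (use assms in auto)

section \<open>Construction of the refinement as a union of subobjects\<close>

lemma dominated_refinement_exists:
  assumes "mk_universe elts" "injectively_complete elts K" "well_powered elts K \<Gamma>"
    and X: "X \<in> Obj K"
  obtains \<rho> where "is_enrichment K \<Gamma> \<Phi> X \<rho>" "dominated_by K \<Gamma> \<Phi> X \<rho>"
proof -
  interpret mk_universe elts by fact
  obtain S where S: "small elts S" "S \<subseteq> {\<sigma> \<in> \<Gamma>. \<sigma> \<in> Arr K \<and> Ran K \<sigma> = X}"
    "\<And>\<rho>. \<rho> \<in> \<Gamma> \<Longrightarrow> \<rho> \<in> Arr K \<Longrightarrow> Ran K \<rho> = X \<Longrightarrow>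
      \<exists>\<sigma> \<in> S. factors_through K \<rho> \<sigma> \<and> factors_through K \<sigma> \<rho>"
    using well_powered_representatives[OF assms(3) X] by blast
  \<comment> \<open>All dominated representatives are taken, not only those of images of \<phi> in
    \<Phi>. The images are covered up to mutual factoring, and any further members keep the union
    dominated.\<close>
  define B where "B = {\<sigma> \<in> S. dominated_by K \<Gamma> \<Phi> X \<sigma>}"
  have "small elts B"
    by (rule small_subset[OF S(1)]) (auto simp: B_def)
  then obtain x g where B: "B = g ` elts x"
    unfolding small_def by blast
  have g: "g i \<in> Arr K" "Ran K (g i) = X" "dominated_by K \<Gamma> \<Phi> X (g i)" if "i \<in> elts x" for i
    using that S(2) B unfolding B_def by blast+
  \<comment> \<open>\<phi> factors through its image \<mu>, hence through the representative
    \<sigma> of \<mu>; \<sigma> lies in \<open>B\<close> because it factors back through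
    \<mu>.\<close>
  have cover: "\<exists>i \<in> elts x. factors_through K \<phi> (g i)" if \<phi>: "\<phi> \<in> \<Phi>" "Ran K \<phi> = X" for \<phi>
  proof -
    obtain \<mu> \<epsilon> where f: "factorization K \<Gamma> \<phi> \<mu> \<epsilon>"
      using factorization_exists \<Phi> \<phi>(1) by blast
    note fD = factorizationD[OF f]
    obtain \<sigma> where \<sigma>: "\<sigma> \<in> S" "factors_through K \<mu> \<sigma>" "factors_through K \<sigma> \<mu>"
      using S(3)[of \<mu>] fD \<phi>(2) by auto
    have "dominated_by K \<Gamma> \<Phi> X \<sigma>"
      using dominated_by_factor[OF dominated_by_image[OF \<phi> f] \<sigma>(3)] fD \<phi>(2) by auto
    then have "\<sigma> \<in> g ` elts x"
      using \<sigma>(1) B unfolding B_def by blast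
    moreover have "factors_through K \<phi> \<mu>"
      by (rule factors_throughI[of \<epsilon>]) (use fD in \<open>auto intro: homI\<close>)
    then have "factors_through K \<phi> \<sigma>"
      using factors_through_trans \<sigma> S(2) by blast
    ultimately show ?thesis by blast
  qed
  have "\<exists>L c. L \<in> Obj K \<and> (\<forall>i \<in> elts x. c i \<in> hom K (Dom K (g i)) L) \<and>
    (\<forall>L' c'. L' \<in> Obj K \<longrightarrow> (\<forall>i \<in> elts x. c' i \<in> hom K (Dom K (g i)) L') \<longrightarrow>
      (\<exists>!u. u \<in> hom K L L' \<and> (\<forall>i \<in> elts x. u \<odot> c i = c' i)))"
    by (rule coproduct_exists[OF assms(2)]) (use g in auto)
  then obtain L c where L: "L \<in> Obj K"
    and all_c: "\<forall>i \<in> elts x. c i \<in> hom K (Dom K (g i)) L"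
    and all_univ: "\<forall>L' c'. L' \<in> Obj K \<longrightarrow> (\<forall>i \<in> elts x. c' i \<in> hom K (Dom K (g i)) L') \<longrightarrow>
      (\<exists>!u. u \<in> hom K L L' \<and> (\<forall>i \<in> elts x. u \<odot> c i = c' i))"
    by (elim exE conjE) (rule that)
  note c = bspec[OF all_c]
  have univ: "\<exists>!u. u \<in> hom K L L' \<and> (\<forall>i \<in> elts x. u \<odot> c i = c' i)"
    if "L' \<in> Obj K" "\<And>i. i \<in> elts x \<Longrightarrow> c' i \<in> hom K (Dom K (g i)) L'" for L' c'
    by (rule all_univ[rule_format]) (rule that)+
  note cD = homD[OF c]
  \<comment> \<open>The members of \<open>B\<close> are glued to one morphism \<open>q\<close> from
    their coproduct; the \<Gamma>-part \<rho> of \<open>q\<close> is their union.\<close>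
  have "\<exists>!q. q \<in> hom K L X \<and> (\<forall>i \<in> elts x. q \<odot> c i = g i)"
    by (rule univ) (use X g in \<open>auto intro: homI\<close>)
  then obtain q where q: "q \<in> hom K L X" "\<And>i. i \<in> elts x \<Longrightarrow> q \<odot> c i = g i"
    by blast
  note qD = homD[OF q(1)]
  obtain \<rho> \<epsilon> where f: "factorization K \<Gamma> q \<rho> \<epsilon>"
    using factorization_exists qD(1) by blast
  note fD = factorizationD[OF f]
  have "is_enrichment K \<Gamma> \<Phi> X \<rho>"
    unfolding is_enrichment_iff
  proof (intro conjI ballI impI)
    show "\<rho> \<in> \<Gamma>" "Ran K \<rho> = X"
      using fD qD by auto
    fix \<phi>
    assume "\<phi> \<in> \<Phi>" "Ran K \<phi> = X"
    then obtain i where i: "i \<in> elts x" "factors_through K \<phi> (g i)"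
      using cover by blast
    have "factors_through K (g i) q"
      by (rule factors_throughI[of "c i"]) (use q(2) c qD i(1) in auto)
    moreover have "factors_through K q \<rho>"
      by (rule factors_throughI[of \<epsilon>]) (use fD in \<open>auto intro: homI\<close>)
    ultimately show "factors_through K \<phi> \<rho>"
      using i(2) factors_through_trans fD(2) qD(1) by blast
  qed
  moreover have "dominated_by K \<Gamma> \<Phi> X \<rho>"
    unfolding dominated_by_def
  proof (intro ballI impI)
    fix \<alpha> s
    assume *: "\<alpha> \<in> Arr K" "s \<in> \<Gamma>" "Dom K \<alpha> = X" "Ran K s = Ran K \<alpha>"
      "\<forall>\<phi> \<in> \<Phi>. Ran K \<phi> = X \<longrightarrow> factors_through K (\<alpha> \<odot> \<phi>) s"
    have s: "s \<in> Arr K"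
      using *(2) \<Gamma>_Arr by blast
    \<comment> \<open>Each member of \<open>B\<close> is dominated, so
      \<open>\<alpha> \<odot> g i\<close> factors through \<open>s\<close>; the lifts
      \<open>t i\<close> then assemble to \<open>u\<close> on the coproduct.\<close>
    have "\<exists>t. t \<in> hom K (Dom K (g i)) (Dom K s) \<and> \<alpha> \<odot> g i = s \<odot> t" if "i \<in> elts x" for i
    proof -
      have "factors_through K (\<alpha> \<odot> g i) s"
        using g(3)[OF that] * unfolding dominated_by_def by blast
      moreover have "Dom K (\<alpha> \<odot> g i) = Dom K (g i)"
        using g[OF that] * by simp
      ultimately show ?thesis
        unfolding factors_through_def by auto
    qed
    then obtain t where t: "\<And>i. i \<in> elts x \<Longrightarrow> t i \<in> hom K (Dom K (g i)) (Dom K s)"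
      "\<And>i. i \<in> elts x \<Longrightarrow> \<alpha> \<odot> g i = s \<odot> t i"
      by metis
    have "\<exists>!u. u \<in> hom K L (Dom K s) \<and> (\<forall>i \<in> elts x. u \<odot> c i = t i)"
      by (rule univ) (use s t(1) in auto)
    then obtain u where u: "u \<in> hom K L (Dom K s)" "\<And>i. i \<in> elts x \<Longrightarrow> u \<odot> c i = t i"
      by blast
    note uD = homD[OF u(1)]
    \<comment> \<open>Only the uniqueness matters here: \<open>\<alpha> \<odot> q\<close> and
      \<open>s \<odot> u\<close> have the same components \<open>\<alpha> \<odot> g i\<close>, hence
      coincide. It then remains to cancel \<epsilon>.\<close>
    have "\<exists>!v. v \<in> hom K L (Ran K \<alpha>) \<and> (\<forall>i \<in> elts x. v \<odot> c i = \<alpha> \<odot> g i)"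
      by (rule univ) (use * g in \<open>auto intro: homI\<close>)
    moreover have "\<alpha> \<odot> q \<in> hom K L (Ran K \<alpha>)" "s \<odot> u \<in> hom K L (Ran K \<alpha>)"
      using * qD uD s by (auto simp: hom_def)
    moreover have "(\<alpha> \<odot> q) \<odot> c i = \<alpha> \<odot> g i" "(s \<odot> u) \<odot> c i = \<alpha> \<odot> g i" if "i \<in> elts x" for i
      using that * qD uD s cD[OF that] q(2) u(2) t(2) by (auto simp: assoc)
    ultimately have "\<alpha> \<odot> q = s \<odot> u"
      by blast
    moreover have "Dom K (\<alpha> \<odot> q) = L"
      using qD * by simp
    ultimately have "factors_through K (\<alpha> \<odot> q) s"
      using u(1) by (intro factors_throughI[of u]) (simp_all only:)
    moreover have "\<alpha> \<odot> q = (\<alpha> \<odot> \<rho>) \<odot> \<epsilon>"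
      using fD qD * by (simp add: assoc)
    ultimately have "factors_through K ((\<alpha> \<odot> \<rho>) \<odot> \<epsilon>) s"
      by simp
    then show "factors_through K (\<alpha> \<odot> \<rho>) s"
      by (rule factors_through_cancel_epi_complement[rotated -1])
        (use fD qD * s in auto)
  qed
  ultimately show ?thesis
    using that by blast
qed

text \<open>Lying above every \<phi> passes up from \<open>r\<close> to \<mu>, and lying below every
  enrichment passes down from \<open>r\<close> to \<mu>.\<close>

lemma refinement_equivI:
  assumes "is_refinement K \<Gamma> \<Phi> X r" "\<mu> \<in> \<Gamma>" "Ran K \<mu> = X"
    and "factors_through K r \<mu>" "factors_through K \<mu> r"
  shows "is_refinement K \<Gamma> \<Phi> X \<mu>"
proof -
  have "factors_through K f \<mu>" if "factors_through K f r" for f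
    using factors_through_trans[OF that assms(4) \<Gamma>_Arr[OF assms(2)]] .
  moreover have "factors_through K \<mu> \<sigma>" if "\<sigma> \<in> \<Gamma>" "factors_through K r \<sigma>" for \<sigma>
    using factors_through_trans[OF assms(5) that(2) \<Gamma>_Arr[OF that(1)]] .
  ultimately show ?thesis
    using assms(1-3) unfolding is_refinement_iff is_enrichment_iff by blast
qed

section \<open>Nets of singletons and their local limits\<close>

lemma net_index_singleton:
  assumes "is_mono K r"
  shows "Obj (net_index K {r}) = {r}"
    and "Arr (net_index K {r}) = {(r, r)}"
    and "transit K r r = Id K (Dom K r)"
proof -
  have r: "r \<in> Arr K" "Id K (Dom K r) \<in> hom K (Dom K r) (Dom K r)"
    using assms Id_hom unfolding is_mono_def by auto
  then have "factors_through K r r"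
    by (intro factors_throughI) auto
  then show "Obj (net_index K {r}) = {r}" "Arr (net_index K {r}) = {(r, r)}"
    by (auto simp: net_index_def)
  show "transit K r r = Id K (Dom K r)"
    unfolding transit_def
    by (rule the_equality) (use r mono_cancel[OF assms] in auto)
qed

lemma cocone_singleton_iff:
  assumes "is_mono K r"
  shows "is_cocone (net_index K {r}) K (Dom K) (\<lambda>(\<rho>, \<sigma>). transit K \<rho> \<sigma>) L c \<longleftrightarrow>
    c r \<in> hom K (Dom K r) L"
proof -
  have "Dom (net_index K {r}) (r, r) = r" "Ran (net_index K {r}) (r, r) = r"
    by (simp_all add: net_index_def)
  then show ?thesis
    unfolding is_cocone_def net_index_singleton[OF assms]
    using net_index_singleton(3)[OF assms] by (auto simp: hom_comp_Id dest: hom_Obj)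
qed

lemma net_limit_singleton_iff:
  assumes "is_mono K r"
  shows "net_limit K {r} L c \<longleftrightarrow> c r \<in> hom K (Dom K r) L \<and>
    (\<forall>L' f. f \<in> hom K (Dom K r) L' \<longrightarrow> (\<exists>!u. u \<in> hom K L L' \<and> u \<odot> c r = f))"
proof -
  \<comment> \<open>A cocone is a total function on morphisms of which only the value at
    \<open>r\<close> counts; constant functions realize every value, so quantifying over
    \<open>c'\<close> amounts to quantifying over that value.\<close>
  have eval: "(\<forall>c'. Q (c' r)) \<longleftrightarrow> (\<forall>f. Q f)" for Q :: "'m \<Rightarrow> bool"
  proof
    assume *: "\<forall>c'. Q (c' r)"
    show "\<forall>f. Q f"
    proof
      fix f
      show "Q f"
        using spec[OF *, of "\<lambda>_. f"] by simp
    qed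
  qed blast
  show ?thesis
    unfolding net_limit_def is_injective_limit_def cocone_singleton_iff[OF assms]
      net_index_singleton[OF assms]
    by (simp add: eval[of "\<lambda>f. f \<in> hom K (Dom K r) L' \<longrightarrow> (\<exists>!u. u \<in> hom K L L' \<and> u \<odot> c r = f)" for L'])
qed

lemma net_limit_singleton_exists:
  assumes "is_mono K r"
  shows "net_limit K {r} (Dom K r) (\<lambda>_. Id K (Dom K r))"
proof -
  have "Dom K r \<in> Obj K"
    using assms unfolding is_mono_def by auto
  then show ?thesis
    unfolding net_limit_singleton_iff[OF assms]
    using Id_hom hom_comp_Id by metis
qed

text \<open>The injective limit is fixed only up to isomorphism, so \<open>l\<close> need not equal
  \<open>r\<close>; the two are compared by factoring in both directions.\<close>

lemma local_limit_factors_through: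
  assumes "is_local_limit K N X l" "N X = {r}" "is_mono K r" "Ran K r = X"
  shows "factors_through K l r" "factors_through K r l"
proof -
  obtain L c where lim: "net_limit K {r} L c" and l: "l \<in> hom K L X" "l \<odot> c r = r"
    using assms(1,2) unfolding is_local_limit_def by auto
  have c: "c r \<in> hom K (Dom K r) L"
    and univ: "\<And>L' f. f \<in> hom K (Dom K r) L' \<Longrightarrow> \<exists>!u. u \<in> hom K L L' \<and> u \<odot> c r = f"
    using lim unfolding net_limit_singleton_iff[OF assms(3)] by auto
  have r: "r \<in> Arr K"
    using assms(3) unfolding is_mono_def by auto
  \<comment> \<open>\<open>u\<close> is a left inverse of the leg \<open>c r\<close>, induced by the
    identity cocone. Both \<open>l\<close> and \<open>r \<odot> u\<close> restrict to
    \<open>r\<close> along the leg, so uniqueness identifies them.\<close>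
  obtain u where u: "u \<in> hom K L (Dom K r)" "u \<odot> c r = Id K (Dom K r)"
    using univ[OF Id_hom[OF Dom_Obj[OF r]]] by blast
  note D = homD[OF l(1)] homD[OF c] homD[OF u(1)]
  have "(r \<odot> u) \<odot> c r = r"
    using D r u(2) by (simp add: assoc)
  moreover have "r \<odot> u \<in> hom K L X" "r \<in> hom K (Dom K r) X"
    using D r assms(4) by (auto simp: hom_def)
  ultimately have "l = r \<odot> u"
    using univ[of r X] l by blast
  then show "factors_through K l r"
    using u D by (intro factors_throughI[of u]) auto
  show "factors_through K r l"
    using l c D by (intro factors_throughI[of "c r"]) auto
qed

lemma local_limit_factorization_refinement:
  assumes "is_refinement K \<Gamma> \<Phi> X r" "N X = {r}" "is_local_limit K N X l"
    and f: "factorization K \<Gamma> l \<mu> \<epsilon>"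
  shows "is_refinement K \<Gamma> \<Phi> X \<mu>"
proof -
  note r = is_refinementD[OF assms(1)]
  note fD = factorizationD[OF f]
  note ll = local_limit_factors_through[OF assms(3,2) r(4,3)]
  have "l \<in> hom K (Dom K l) X"
    using assms(3) unfolding is_local_limit_def by (auto simp: hom_def)
  then have \<mu>: "Ran K \<mu> = X"
    using fD by (auto simp: hom_def)
  have "factors_through K l \<mu>"
    by (rule factors_throughI[of \<epsilon>]) (use fD in \<open>auto intro: homI\<close>)
  then have "factors_through K r \<mu>"
    using ll(2) factors_through_trans fD(2) by blast
  \<comment> \<open>Since \<open>l = \<mu> \<odot> \<epsilon>\<close> factors through
    \<open>r\<close>, which is in \<Gamma>, the diagonal cancels \<epsilon>.\<close>
  moreover have "factors_through K \<mu> r"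
    by (rule factors_through_cancel_epi_complement[of _ \<Gamma> \<epsilon>]) (use fD r \<mu> ll(1) in auto)
  ultimately show ?thesis
    using refinement_equivI[OF assms(1) fD(1) \<mu>] by blast
qed

section \<open>Functoriality of a choice of refinements\<close>

lemma refinement_functorialI:
  assumes ex: "\<And>X. X \<in> Obj K \<Longrightarrow> is_refinement K \<Gamma> \<Phi> X (i X)"
    and lift: "\<And>\<alpha>. \<alpha> \<in> Arr K \<Longrightarrow> \<exists>\<beta>. \<beta> \<in> hom K (Dom K (i (Dom K \<alpha>))) (Dom K (i (Ran K \<alpha>))) \<and>
      \<alpha> \<odot> i (Dom K \<alpha>) = i (Ran K \<alpha>) \<odot> \<beta>"
  shows "refinement_functorial K \<Gamma> \<Phi>"
proof -
  define I where "I X = Dom K (i X)" for X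
  have i: "i X \<in> hom K (I X) X" "is_mono K (i X)" "i X \<in> Arr K" "Ran K (i X) = X" if "X \<in> Obj K" for X
    using is_refinementD[OF ex[OF that]] by (auto simp: hom_def I_def)
  obtain Im where Im: "\<And>\<alpha>. \<alpha> \<in> Arr K \<Longrightarrow> Im \<alpha> \<in> hom K (I (Dom K \<alpha>)) (I (Ran K \<alpha>))"
    "\<And>\<alpha>. \<alpha> \<in> Arr K \<Longrightarrow> \<alpha> \<odot> i (Dom K \<alpha>) = i (Ran K \<alpha>) \<odot> Im \<alpha>"
    using lift unfolding I_def by metis
  have I_Obj: "I X \<in> Obj K" if "X \<in> Obj K" for X
    using i(3)[OF that] by (simp add: I_def)
  \<comment> \<open>Both functor laws equate morphisms into the domain of a monomorphism
    \<open>i X\<close>, so it suffices to compare them after composition with it, where the defining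
    squares of \<open>Im\<close> apply.\<close>
  have Im_Id: "Im (Id K X) = Id K (I X)" if X: "X \<in> Obj K" for X
  proof (rule mono_cancel[OF i(2)[OF X]])
    have Id: "Id K X \<in> Arr K" "Dom K (Id K X) = X" "Ran K (Id K X) = X"
      using X by auto
    show "Im (Id K X) \<in> hom K (I X) (Dom K (i X))"
      using Im(1)[OF Id(1)] unfolding Id(2,3) by (simp add: I_def)
    show "Id K (I X) \<in> hom K (I X) (Dom K (i X))"
      using Id_hom[OF I_Obj[OF X]] by (simp add: I_def)
    have "i X \<odot> Im (Id K X) = Id K X \<odot> i X"
      using Im(2)[OF Id(1)] unfolding Id(2,3) by simp
    also have "\<dots> = i X"
      using Id_comp[OF i(3)[OF X]] i(4)[OF X] by simp
    also have "\<dots> = i X \<odot> Id K (I X)"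
      using comp_Id[OF i(3)[OF X]] by (simp add: I_def)
    finally show "i X \<odot> Im (Id K X) = i X \<odot> Id K (I X)" .
  qed
  have Im_comp: "Im (g \<odot> f) = Im g \<odot> Im f"
    if fg: "f \<in> Arr K" "g \<in> Arr K" "Dom K g = Ran K f" for f g
  proof (rule mono_cancel[of "i (Ran K g)" _ "I (Dom K f)"])
    note If = homD[OF Im(1)[OF fg(1)]] and Ig = homD[OF Im(1)[OF fg(2)]]
    note i' = i(3,4)[OF Dom_Obj[OF fg(1)]] i(3,4)[OF Ran_Obj[OF fg(1)]] i(3,4)[OF Ran_Obj[OF fg(2)]]
    show "is_mono K (i (Ran K g))"
      using i(2) fg by simp
    show "Im (g \<odot> f) \<in> hom K (I (Dom K f)) (Dom K (i (Ran K g)))"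
      using Im(1)[of "g \<odot> f"] fg by (simp add: I_def)
    show "Im g \<odot> Im f \<in> hom K (I (Dom K f)) (Dom K (i (Ran K g)))"
      by (rule homI) (use If Ig fg in \<open>auto simp: I_def\<close>)
    have "i (Ran K g) \<odot> Im (g \<odot> f) = (g \<odot> f) \<odot> i (Dom K f)"
      using Im(2)[of "g \<odot> f"] fg by simp
    also have "\<dots> = g \<odot> (i (Ran K f) \<odot> Im f)"
      using fg i' Im(2)[OF fg(1)] by (simp add: assoc)
    also have "\<dots> = (g \<odot> i (Ran K f)) \<odot> Im f"
      using fg i' If by (simp add: assoc I_def)
    also have "\<dots> = (i (Ran K g) \<odot> Im g) \<odot> Im f"
      using Im(2)[OF fg(2)] fg(3) by simp
    also have "\<dots> = i (Ran K g) \<odot> (Im g \<odot> Im f)"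
      by (rule assoc) (use If Ig i' fg in \<open>auto simp: I_def\<close>)
    finally show "i (Ran K g) \<odot> Im (g \<odot> f) = i (Ran K g) \<odot> (Im g \<odot> Im f)" .
  qed
  have "is_functor K K I Im"
    unfolding is_functor_def using I_Obj Im(1) Im_Id Im_comp by blast
  moreover have "Im \<alpha> \<in> hom K (I Y) (I X) \<and> i X \<odot> Im \<alpha> = \<alpha> \<odot> i Y" if "\<alpha> \<in> hom K Y X" for \<alpha> X Y
    using Im[of \<alpha>] that by (auto simp: hom_def)
  ultimately show ?thesis
    unfolding refinement_functorial_def using ex i(1) by blast
qed

end

theorem theorem0p1p26:
  fixes elts :: "'v \<Rightarrow> 'v set"
    and K :: "('v, 'v) cat"
    and \<Gamma> \<Phi> :: "'v set"
  assumes universe: "mk_universe elts"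
    and K: "category K"
    and \<Gamma>: "\<Gamma> \<subseteq> Arr K"
    and \<Phi>: "\<Phi> \<subseteq> Arr K"
    and RR1: "injectively_complete elts K"
    and RR2: "epimorphically_complementable K \<Gamma>"
    and RR3: "well_powered elts K \<Gamma>"
    and RR4_range: "\<forall>X \<in> Obj K. \<exists>\<phi> \<in> \<Phi>. Ran K \<phi> = X"
    and RR4_ideal: "\<forall>\<phi> \<in> \<Phi>. \<forall>\<alpha> \<in> Arr K. Dom K \<alpha> = Ran K \<phi> \<longrightarrow> \<alpha> \<odot>\<^bsub>K\<^esub> \<phi> \<in> \<Phi>"
  shows "(\<exists>N. net_of_monos elts K N \<and>
      (\<forall>X \<in> Obj K. \<forall>l \<mu> \<epsilon>. is_local_limit K N X l \<longrightarrow> factorization K \<Gamma> l \<mu> \<epsilon> \<longrightarrow>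
        is_refinement K \<Gamma> \<Phi> X \<mu>)) \<and>
    (\<forall>X \<in> Obj K. \<forall>Y \<in> Obj K. \<forall>\<alpha> \<in> hom K X Y. \<forall>r s.
      is_refinement K \<Gamma> \<Phi> X r \<longrightarrow> is_refinement K \<Gamma> \<Phi> Y s \<longrightarrow>
      (\<exists>!\<beta>. \<beta> \<in> hom K (Dom K r) (Dom K s) \<and> \<alpha> \<odot>\<^bsub>K\<^esub> r = s \<odot>\<^bsub>K\<^esub> \<beta>)) \<and>
    refinement_functorial K \<Gamma> \<Phi>"
proof -
  interpret mk_universe elts by (fact universe)
  interpret complementable_cat K \<Gamma> \<Phi>
    by unfold_locales (fact K \<Phi> RR2)+
  have ex_dominated: "\<exists>\<rho>. is_enrichment K \<Gamma> \<Phi> X \<rho> \<and> dominated_by K \<Gamma> \<Phi> X \<rho>"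
    if "X \<in> Obj K" for X
    using dominated_refinement_exists[OF universe RR1 RR3 that] by blast
  \<comment> \<open>Part (b) concerns arbitrary refinements, while the construction yields one. Any
    refinement factors through that one and so inherits domination.\<close>
  have dominated: "dominated_by K \<Gamma> \<Phi> X r" if r: "is_refinement K \<Gamma> \<Phi> X r" for X r
  proof -
    have "X \<in> Obj K"
      using is_refinementD[OF r] by auto
    then obtain \<rho> where \<rho>: "is_enrichment K \<Gamma> \<Phi> X \<rho>" "dominated_by K \<Gamma> \<Phi> X \<rho>"
      using ex_dominated by blast
    moreover have "factors_through K r \<rho>"
      using r \<rho>(1) unfolding is_refinement_iff by blast
    ultimately show ?thesis
      using dominated_by_factor \<Gamma>_Arr unfolding is_enrichment_iff by blast
  qed
  \<comment> \<open>By the ideal property \<open>\<alpha> \<odot> \<phi>\<close> is in \<Phi>, so it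
    factors through the enrichment \<open>s\<close>; domination replaces \<phi> by \<open>r\<close>,
    and uniqueness holds because \<open>s\<close> is mono.\<close>
  have b: "\<exists>!\<beta>. \<beta> \<in> hom K (Dom K r) (Dom K s) \<and> \<alpha> \<odot>\<^bsub>K\<^esub> r = s \<odot>\<^bsub>K\<^esub> \<beta>"
    if \<alpha>: "\<alpha> \<in> hom K X Y" and r: "is_refinement K \<Gamma> \<Phi> X r" and s: "is_refinement K \<Gamma> \<Phi> Y s"
    for X Y \<alpha> r s
  proof -
    note rD = is_refinementD[OF r] and sD = is_refinementD[OF s] and \<alpha>D = homD[OF \<alpha>]
    have "factors_through K (\<alpha> \<odot>\<^bsub>K\<^esub> \<phi>) s" if "\<phi> \<in> \<Phi>" "Ran K \<phi> = X" for \<phi>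
    proof -
      have "\<phi> \<in> Arr K" "\<alpha> \<odot>\<^bsub>K\<^esub> \<phi> \<in> \<Phi>"
        using that \<Phi> RR4_ideal \<alpha>D by auto
      moreover have "Ran K (\<alpha> \<odot>\<^bsub>K\<^esub> \<phi>) = Y"
        using \<open>\<phi> \<in> Arr K\<close> that(2) \<alpha>D by simp
      ultimately show ?thesis
        using sD(5) unfolding is_enrichment_iff by blast
    qed
    then have "factors_through K (\<alpha> \<odot>\<^bsub>K\<^esub> r) s"
      using dominated[OF r] \<alpha>D sD unfolding dominated_by_def by auto
    then show ?thesis
      unfolding ex1_factor_iff[OF sD(4)] factors_through_def using rD \<alpha>D by simp
  qed
  obtain i where i: "\<And>X. X \<in> Obj K \<Longrightarrow> is_refinement K \<Gamma> \<Phi> X (i X)"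
    using ex_dominated enrichment_dominated_imp_refinement by metis
  have c: "refinement_functorial K \<Gamma> \<Phi>"
  proof (rule refinement_functorialI[OF i])
    fix \<alpha>
    assume "\<alpha> \<in> Arr K"
    then show "\<exists>\<beta>. \<beta> \<in> hom K (Dom K (i (Dom K \<alpha>))) (Dom K (i (Ran K \<alpha>))) \<and>
        \<alpha> \<odot>\<^bsub>K\<^esub> i (Dom K \<alpha>) = i (Ran K \<alpha>) \<odot>\<^bsub>K\<^esub> \<beta>"
      using b[of \<alpha>, OF _ i i] by (auto simp: hom_def)
  qed
  have refl: "factors_through K (i X) (i X)" if "X \<in> Obj K" for X
    using i[OF that] unfolding is_refinement_iff by blast
  \<comment> \<open>Directedness is reflexivity of factoring, the limit is the domain of
    \<open>i X\<close>, and the compatibility with morphisms is part (b).\<close>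
  have "net_of_monos elts K (\<lambda>X. {i X})"
    unfolding net_of_monos_def
  proof (intro conjI ballI)
    fix X Y \<alpha> \<sigma>
    assume "X \<in> Obj K" "Y \<in> Obj K" "\<alpha> \<in> hom K X Y" "\<sigma> \<in> {i X}"
    then show "\<exists>\<tau> \<in> {i Y}. \<exists>\<alpha>' \<in> hom K (Dom K \<sigma>) (Dom K \<tau>). \<tau> \<odot>\<^bsub>K\<^esub> \<alpha>' = \<alpha> \<odot>\<^bsub>K\<^esub> \<sigma>"
      using b[OF _ i i] by (metis singletonD singletonI)
  next
    fix X
    assume "X \<in> Obj K"
    then show "\<exists>L c. net_limit K {i X} L c"
      using net_limit_singleton_exists is_refinementD(4)[OF i] by blast
  qed (use small_singleton is_refinementD[OF i] refl in auto)
  moreover have "is_refinement K \<Gamma> \<Phi> X \<mu>"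
    if "X \<in> Obj K" "is_local_limit K (\<lambda>X. {i X}) X l" "factorization K \<Gamma> l \<mu> \<epsilon>" for X l \<mu> \<epsilon>
    using local_limit_factorization_refinement[OF i[OF that(1)] _ that(2,3)] by simp
  ultimately show ?thesis
    using b c by blast
qed

end
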